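(* Let $D$ be a connected Eulerian digraph that is not a cycle. For a set $A\subseteq E(D)$ let $|\mathfrak{C}(A)|$ denote the number of Eulerian circuits of the subdigraph formed by the edges in $A$ and their endpoints (this is $0$ if that subdigraph is not Eulerian). For a set partition $a=\{A_1,\ldots,A_k\}$ of $E(D)$ put $F(a)=\prod_{i=1}^k\bigl(-|\mathfrak{C}(A_i)|\bigr)$. Then $$\sum_{a} F(a)=0,$$ where the sum ranges over all set partitions $a$ of $E(D)$.
   Context: A digraph is a finite multi-digraph (each edge $e$ has an ordered pair $\psi(e)=(u,v)$ of distinct vertices; parallel edges allowed, no loops). A closed trail is a sequence $(v_0,e_1,v_1,\ldots,e_d,v_d)$, $d\ge1$, with $\psi(e_i)=(v_{i-1},v_i)$, pairwise distinct edges and $v_d=v_0$; a circuit is a closed trail up to cyclic rotation. An Eulerian circuit uses every edge; a digraph is Eulerian if it has one. A cycle is a circuit with no repeated vertex. *)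

theory Defs
  imports "Graph_Theory.Euler" "HOL-Library.Disjoint_Sets"
begin

text \<open>
  Finite loop-free multi-digraphs are the digraphs satisfying both \<open>fin_digraph\<close> and
  \<open>loopfree_digraph\<close> (the library's locale \<open>digraph\<close> forbids parallel arcs).
\<close>

text \<open>
  A closed trail is given by its list of arcs; since the list is non-empty, the arcs
  determine the vertices \<open>v\<^sub>0, \<dots>, v\<^sub>d\<close> of the trail.
\<close>
definition closed_trails :: "('a, 'b) pre_digraph \<Rightarrow> 'b list set" where
  "closed_trails G = {p. p \<noteq> [] \<and> (\<exists>u. pre_digraph.trail G u p u)}"

definition cyclic_rotation :: "('b list \<times> 'b list) set" where
  "cyclic_rotation = {(p, q). \<exists>n. q = rotate n p}"

definition circuits :: "('a, 'b) pre_digraph \<Rightarrow> 'b list set set" where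
  "circuits G = closed_trails G // cyclic_rotation"

definition euler_circuits :: "('a, 'b) pre_digraph \<Rightarrow> 'b list set set" where
  "euler_circuits G = {C \<in> circuits G. \<forall>p\<in>C. set p = arcs G}"

definition eulerian :: "('a, 'b) pre_digraph \<Rightarrow> bool" where
  "eulerian G \<longleftrightarrow> euler_circuits G \<noteq> {}"

text \<open>
  \<open>G\<close> consists of the arcs and vertices of a single cycle: some circuit without
  repeated vertices traverses all arcs and all vertices of \<open>G\<close>.  In the library's \<open>cycle\<close>
  only the coincidence of the first and the last vertex is disregarded.
\<close>
definition is_cycle :: "('a, 'b) pre_digraph \<Rightarrow> bool" where
  "is_cycle G \<longleftrightarrow> (\<exists>u p. pre_digraph.cycle G p \<and> pre_digraph.euler_trail G u p u)"

definition arc_subgraph :: "('a, 'b) pre_digraph \<Rightarrow> 'b set \<Rightarrow> ('a, 'b) pre_digraph" where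
  "arc_subgraph G A =
     \<lparr>verts = tail G ` A \<union> head G ` A, arcs = A, tail = tail G, head = head G\<rparr>"

definition partition_weight :: "('a, 'b) pre_digraph \<Rightarrow> 'b set set \<Rightarrow> int" where
  "partition_weight G P = (\<Prod>A\<in>P. - int (card (euler_circuits (arc_subgraph G A))))"


text \<open>
  Well-definedness: rotation is an equivalence relation, closed trails are closed under
  it, and all sets counted or summed over are finite.
\<close>

lemma equiv_cyclic_rotation: "equiv UNIV cyclic_rotation"
proof (rule equivI)
  show "refl cyclic_rotation"
    unfolding refl_on_def cyclic_rotation_def
    by (auto intro: exI[of _ 0])
  show "sym cyclic_rotation"
  proof (rule symI)
    fix p q :: "'c list" assume "(p, q) \<in> cyclic_rotation"
    then obtain n where q: "q = rotate n p" by (auto simp: cyclic_rotation_def)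
    have "rotate (length p - n mod length p) (rotate (n mod length p) p) = p"
      by (cases "p = []") (simp_all add: rotate_rotate rotate_id)
    then have "p = rotate (length p - n mod length p) q"
      by (simp add: q rotate_conv_mod[symmetric])
    then show "(q, p) \<in> cyclic_rotation" by (auto simp: cyclic_rotation_def)
  qed
  show "trans cyclic_rotation"
    unfolding trans_def cyclic_rotation_def by (auto simp: rotate_rotate)
qed simp

lemma (in wf_digraph) rotate1_closed_trails:
  assumes "p \<in> closed_trails G"
  shows "rotate1 p \<in> closed_trails G"
proof -
  obtain u where p: "p \<noteq> []" "trail u p u" using assms by (auto simp: closed_trails_def)
  then obtain e es where es: "p = e # es" by (cases p) auto
  with p have "trail (head G e) (es @ [e]) (head G e)"
    by (auto simp: trail_def awalk_Cons_iff awalk_append_iff awalk_Nil_iff)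
  then show ?thesis by (auto simp: closed_trails_def es)
qed

lemma (in wf_digraph) circuit_subset_closed_trails:
  assumes "C \<in> circuits G"
  shows "C \<subseteq> closed_trails G"
proof
  fix q assume "q \<in> C"
  with assms obtain p n where p: "p \<in> closed_trails G" and q: "q = rotate n p"
    by (auto simp: circuits_def quotient_def cyclic_rotation_def)
  have "rotate n p \<in> closed_trails G"
    using p by (induction n) (auto intro: rotate1_closed_trails)
  then show "q \<in> closed_trails G" by (simp add: q)
qed

lemma (in fin_digraph) finite_euler_circuits: "finite (euler_circuits G)"
proof -
  have "finite (closed_trails G)"
    by (rule finite_subset[OF _ trails_finite]) (auto simp: closed_trails_def)
  then have "finite (circuits G)" by (simp add: circuits_def quotient_def)
  then show ?thesis by (simp add: euler_circuits_def)
qed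

lemma fin_digraph_arc_subgraph: "finite A \<Longrightarrow> fin_digraph (arc_subgraph G A)"
  by unfold_locales (auto simp: arc_subgraph_def)

lemma (in fin_digraph) finite_partitions: "finite {P. partition_on (arcs G) P}"
  by (rule finitely_many_partition_on) simp

end

theory Submission
  imports Defs "HOL-Combinatorics.Cycles" "HOL-Combinatorics.Orbits"
begin

text \<open>
  A circuit on the arc set \<open>A\<close> is the same thing as a cyclic permutation \<open>f\<close> of \<open>A\<close> such that
  the arc \<open>f e\<close> starts where \<open>e\<close> ends, and \<open>-1\<close> equals \<open>(-1)\<^bsup>|A|\<^esup> sign f\<close>.  By the
  decomposition of permutations into cycles, the sum over all partitions is therefore
  \<open>(-1)\<^bsup>|E|\<^esup>\<close> times the sum of \<open>sign f\<close> over all permutations \<open>f\<close> of the arcs such that \<open>f e\<close>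
  always starts where \<open>e\<close> ends.  If two arcs \<open>a \<noteq> b\<close> have the same head, composing with the
  transposition of \<open>a\<close> and \<open>b\<close> reverses all signs, so this sum vanishes.  If there are no such
  arcs, then the Eulerian circuit does not repeat a vertex and the digraph is a cycle.
\<close>

section \<open>Lists and cyclic permutations\<close>

text \<open>Applying the \<open>n\<close>-th iterate of the cycle to every entry of \<open>p\<close>
  rotates \<open>p\<close> by \<open>n\<close> places; compare the first entries.\<close>

lemma cycle_of_list_nth:
  assumes "distinct p" "n < length p"
  shows "p ! n = (cycle_of_list p ^^ n) (hd p)"
proof -
  have "p \<noteq> []" using assms by auto
  then have "(cycle_of_list p ^^ n) (hd p) = hd (map (cycle_of_list p ^^ n) p)"
    by (simp add: hd_map)
  also have "\<dots> = p ! n"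
    using assms \<open>p \<noteq> []\<close> by (simp add: cyclic_rotation hd_rotate_conv_nth)
  finally show ?thesis by simp
qed

lemma map_cycle_of_list:
  "distinct p \<Longrightarrow> map (cycle_of_list p) p = rotate1 p"
  using cyclic_rotation[of p 1] by simp

lemma cyclic_on_cycle_of_list:
  assumes "distinct p" "p \<noteq> []"
  shows "cyclic_on (cycle_of_list p) (set p)"
proof (rule cyclic_on_singleI)
  show "hd p \<in> set p" using assms by simp
  show "set p = orbit (cycle_of_list p) (hd p)"
  proof
    show "set p \<subseteq> orbit (cycle_of_list p) (hd p)"
      using assms by (fastforce simp: orbit_altdef_permutation[OF permutation_of_cycle]
          in_set_conv_nth cycle_of_list_nth)
    show "orbit (cycle_of_list p) (hd p) \<subseteq> set p"
      by (rule permutes_orbit_subset[OF cycle_permutes]) (use assms in simp)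
  qed
qed

lemma ex_cycle_of_list:
  assumes "f permutes A" "cyclic_on f A"
  obtains p where "p \<noteq> []" "distinct p" "set p = A" "cycle_of_list p = f"
proof -
  obtain x where x: "x \<in> A" "A = orbit f x" using assms by (auto simp: cyclic_on_def)
  then have self: "x \<in> orbit f x" by simp
  \<comment> \<open>\<open>n\<close> is the first return time of \<open>x\<close>, so the list
    \<open>p\<close> of iterates goes round the orbit exactly once.\<close>
  define n where "n = funpow_dist1 f x x"
  define p where "p = map (\<lambda>i. (f ^^ i) x) [0..<n]"
  have n: "n > 0" "(f ^^ n) x = x"
    unfolding n_def using funpow_dist1_prop[OF self] by simp_all
  have p: "distinct p" "set p = A" "p \<noteq> []"
    using inj_on_funpow_dist1[OF self] orbit_conv_funpow_dist1[OF self] x n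
    by (simp_all add: p_def distinct_map n_def[symmetric])
  have "map (cycle_of_list p) p = map f p"
    unfolding map_cycle_of_list[OF p(1)]
  proof (rule nth_equalityI)
    fix i assume "i < length (rotate1 p)"
    then have "i < n" by (simp add: p_def)
    then show "rotate1 p ! i = map f p ! i"
      \<comment> \<open>The case \<open>Suc i = n\<close> is the wrap-around: \<open>rotate1\<close>
        puts \<open>x\<close> last, and \<open>(f ^^ n) x = x\<close>.\<close>
      using n by (cases "Suc i = n") (auto simp: nth_rotate1 p_def)
  qed simp
  then have "cycle_of_list p y = f y" if "y \<in> A" for y
    using that p by simp
  moreover have "cycle_of_list p y = f y" if "y \<notin> A" for y
    using that p assms by (simp add: id_outside_supp permutes_not_in)
  ultimately have "cycle_of_list p = f" by blast
  with p that show thesis by blast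
qed

text \<open>Once \<open>p\<close> is rotated to begin with \<open>hd q\<close>, both lists consist
  of the iterates of the same permutation at the same starting point.\<close>

lemma cycle_of_list_eqD:
  assumes "distinct p" "distinct q" "set p = set q" "cycle_of_list p = cycle_of_list q"
  obtains n where "q = rotate n p"
proof (cases "q = []")
  case True
  with assms that[of 0] show thesis by simp
next
  case False
  then have "hd q \<in> set p" using assms by simp
  then obtain n where n: "n < length p" "p ! n = hd q" by (metis in_set_conv_nth)
  define r where "r = rotate n p"
  have "p \<noteq> []" using n by auto
  then have r: "distinct r" "hd r = hd q" "cycle_of_list r = cycle_of_list q"
    using n assms cycle_of_list_rotate_independent[of p n]
    by (auto simp: r_def hd_rotate_conv_nth)
  have "length r = length q"
    using assms by (simp add: r_def flip: distinct_card)
  then have "q = r"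
    using assms r by (auto intro!: nth_equalityI simp: cycle_of_list_nth)
  then show thesis by (intro that[of n]) (simp add: r_def)
qed

text \<open>A list of length \<open>d\<close> unfolds into \<open>d - 1\<close> transpositions; the
  outer minus sign replaces the subtraction in the exponent.\<close>

lemma sign_cycle_of_list: "distinct p \<Longrightarrow> p \<noteq> [] \<Longrightarrow> sign (cycle_of_list p) = - ((-1) ^ length p)"
  by (induction p rule: cycle_of_list.induct)
    (auto simp: sign_compose permutation_swap_id permutation_of_cycle sign_swap_id)

lemma sign_cyclic_on:
  assumes "f permutes A" "cyclic_on f A"
  shows "sign f = - ((-1) ^ card A)"
  using assms by (auto elim!: ex_cycle_of_list simp: sign_cycle_of_list distinct_card)


section \<open>Permutations with a prescribed orbit partition\<close>

text \<open>\<open>R e e'\<close> is to mean that \<open>e'\<close> may follow \<open>e\<close>. The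
  instance \<open>P = {A}\<close> will encode the circuits through all of \<open>A\<close>; a fixed
  point counts as a one-element cycle.\<close>

definition cyclic_perms :: "('a \<Rightarrow> 'a \<Rightarrow> bool) \<Rightarrow> 'a set set \<Rightarrow> ('a \<Rightarrow> 'a) set" where
  "cyclic_perms R P = {f. f permutes \<Union>P \<and> (\<forall>e\<in>\<Union>P. R e (f e)) \<and> (\<forall>A\<in>P. cyclic_on f A)}"

text \<open>A permutation with orbits \<open>P\<close> is a free choice of one cycle on each block,
  and \<open>sign\<close> is multiplicative. The induction splits off one block at a time.\<close>

lemma sum_sign_cyclic_perms:
  assumes "finite P" "disjoint P" "\<And>A. A \<in> P \<Longrightarrow> finite A"
  shows "(\<Sum>f\<in>cyclic_perms R P. sign f) = (\<Prod>A\<in>P. \<Sum>f\<in>cyclic_perms R {A}. sign f)"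
  using assms
proof (induction P)
  case empty
  then show ?case by (simp add: cyclic_perms_def)
next
  case (insert A P)
  have disj: "A \<inter> \<Union>P = {}"
    using insert.hyps insert.prems by (auto simp: disjoint_def)
  have fin: "finite A" "finite (\<Union>P)" using insert by auto
  have "(\<Sum>f\<in>cyclic_perms R (insert A P). sign f)
      = (\<Sum>(f, g)\<in>cyclic_perms R {A} \<times> cyclic_perms R P. sign f * sign g)"
  proof (rule sum.reindex_bij_witness[where i = "\<lambda>(f, g). f \<circ> g"
        and j = "\<lambda>h. (perm_restrict h A, perm_restrict h (\<Union>P))"])
    fix h assume h: "h \<in> cyclic_perms R (insert A P)"
    then have perm: "h permutes A \<union> \<Union>P" and cyc: "cyclic_on h A"
      by (auto simp: cyclic_perms_def)
    have P: "perm_restrict h (\<Union>P) permutes \<Union>P"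
      using perm_restrict_diff_cyclic[OF perm cyc] disj
      by (simp add: Un_Diff Diff_triv Int_commute)
    have A: "perm_restrict h A permutes A"
    proof -
      \<comment> \<open>An injective self-map of the finite set \<open>A\<close> is onto.\<close>
      have "h ` A \<subseteq> A" using cyclic_on_inI[OF cyc] by auto
      then have "bij_betw (perm_restrict h A) A A"
        using permutes_inj_on[OF perm, of A] fin(1)
        by (auto simp: bij_betw_def perm_restrict_def inj_on_def endo_inj_surj)
      then show ?thesis
        by (rule bij_imp_permutes) (simp add: perm_restrict_simps)
    qed
    have comp: "perm_restrict h A \<circ> perm_restrict h (\<Union>P) = h"
      using perm_restrict_union[OF A P disj] perm by simp
    show "(case (perm_restrict h A, perm_restrict h (\<Union>P)) of (f, g) \<Rightarrow> f \<circ> g) = h"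
      using comp by simp
    show "(perm_restrict h A, perm_restrict h (\<Union>P)) \<in> cyclic_perms R {A} \<times> cyclic_perms R P"
    proof -
      have "cyclic_on (perm_restrict h (\<Union>P)) B" if "B \<in> P" for B
      proof -
        have "cyclic_on h B" using h that by (simp add: cyclic_perms_def)
        also have "cyclic_on h B = cyclic_on (perm_restrict h (\<Union>P)) B"
          using that by (intro cyclic_cong) (auto simp: perm_restrict_def)
        finally show ?thesis .
      qed
      then show ?thesis
        using A P h by (auto simp: cyclic_perms_def cyclic_on_perm_restrict perm_restrict_def)
    qed
    show "(case (perm_restrict h A, perm_restrict h (\<Union>P)) of (f, g) \<Rightarrow> sign f * sign g) = sign h"
    proof -
      have "permutation (perm_restrict h A)" "permutation (perm_restrict h (\<Union>P))"
        using A P fin permutation_permutes by blast+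
      from sign_compose[OF this] show ?thesis by (simp add: comp)
    qed
  next
    fix fg assume "fg \<in> cyclic_perms R {A} \<times> cyclic_perms R P"
    then obtain f g where fg: "fg = (f, g)" and f: "f \<in> cyclic_perms R {A}"
      and g: "g \<in> cyclic_perms R P" by auto
    have pf: "f permutes A" and pg: "g permutes \<Union>P"
      using f g by (auto simp: cyclic_perms_def)
    \<comment> \<open>The supports are disjoint, so on each of the two sets only one factor acts and
      the pair can be recovered by restriction.\<close>
    have onA: "(f \<circ> g) e = f e" if "e \<in> A" for e
    proof -
      have "e \<notin> \<Union>P" using that disj by blast
      then show ?thesis using permutes_not_in[OF pg] by simp
    qed
    have onP: "(f \<circ> g) e = g e" if "e \<in> \<Union>P" for e
    proof -
      have "g e \<in> \<Union>P" using that permutes_in_image[OF pg] by blast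
      then have "g e \<notin> A" using disj by blast
      then show ?thesis using permutes_not_in[OF pf] by simp
    qed
    have "f \<circ> g permutes A \<union> \<Union>P"
      using pf pg by (intro permutes_compose) (auto intro: permutes_subset)
    moreover have "cyclic_on (f \<circ> g) A"
      using f cyclic_cong[of A "f \<circ> g" f] onA by (simp add: cyclic_perms_def)
    moreover have "cyclic_on (f \<circ> g) B" if "B \<in> P" for B
      using g that cyclic_cong[of B "f \<circ> g" g] onP by (auto simp: cyclic_perms_def)
    moreover have "R e ((f \<circ> g) e)" if "e \<in> A \<union> \<Union>P" for e
    proof (cases "e \<in> A")
      case True
      then show ?thesis using f onA[of e] by (simp add: cyclic_perms_def)
    next
      case False
      then have e: "e \<in> \<Union>P" using that by blast
      moreover have "\<forall>e\<in>\<Union>P. R e (g e)" using g by (simp add: cyclic_perms_def)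
      ultimately have "R e (g e)" by blast
      then show ?thesis using onP[OF e] by simp
    qed
    ultimately show "(case fg of (f, g) \<Rightarrow> f \<circ> g) \<in> cyclic_perms R (insert A P)"
      by (auto simp: cyclic_perms_def fg)
    have "perm_restrict (f \<circ> g) A = f"
      using onA permutes_not_in[OF pf] by (auto simp: perm_restrict_def fun_eq_iff)
    moreover have "perm_restrict (f \<circ> g) (\<Union>P) = g"
      using onP permutes_not_in[OF pg] by (auto simp: perm_restrict_def fun_eq_iff)
    ultimately show "(perm_restrict (case fg of (f, g) \<Rightarrow> f \<circ> g) A,
        perm_restrict (case fg of (f, g) \<Rightarrow> f \<circ> g) (\<Union>P)) = fg"
      by (simp add: fg)
  qed
  also have "\<dots> = (\<Sum>f\<in>cyclic_perms R {A}. sign f) * (\<Sum>g\<in>cyclic_perms R P. sign g)"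
    by (simp add: sum_product sum.cartesian_product)
  finally show ?case
    using insert by (simp add: disjoint_def)
qed

lemma UN_cyclic_perms:
  assumes "finite S"
  shows "(\<Union>P\<in>{P. partition_on S P}. cyclic_perms R P)
    = {f. f permutes S \<and> (\<forall>e\<in>S. R e (f e))}" (is "?L = ?R")
proof
  show "?L \<subseteq> ?R" by (auto simp: cyclic_perms_def partition_on_def)
  show "?R \<subseteq> ?L"
  proof
    fix f assume f: "f \<in> ?R"
    then have perm: "f permutes S" by simp
    obtain C where C: "\<forall>c\<in>C. cyclic_on f c" "\<Union>C = S"
      "\<forall>c1\<in>C. \<forall>c2\<in>C. c1 \<noteq> c2 \<longrightarrow> c1 \<inter> c2 = {}"
      using permutes_decompose[OF perm assms] by blast
    \<comment> \<open>Non-emptiness of the blocks comes from \<open>cyclic_on\<close>, which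
      excludes the empty set.\<close>
    then have "partition_on S C"
      by (auto simp: partition_on_def disjoint_def cyclic_on_alldef)
    moreover have "f \<in> cyclic_perms R C" using C f by (auto simp: cyclic_perms_def)
    ultimately show "f \<in> ?L" by blast
  qed
qed

text \<open>The block of \<open>s\<close> must be \<open>orbit f s\<close> in either partition. By
  symmetry the partitions coincide, so different partitions have no permutation in common.\<close>

lemma cyclic_perms_partition_unique:
  assumes "partition_on S P" "partition_on S Q" "f \<in> cyclic_perms R P" "f \<in> cyclic_perms R Q"
  shows "P \<subseteq> Q"
proof
  fix A assume A: "A \<in> P"
  then have "A \<noteq> {}" using assms(1) by (auto simp: partition_on_def)
  then obtain s where s: "s \<in> A" by blast
  then have "s \<in> \<Union>Q" using A assms(1,2) by (auto simp: partition_on_def)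
  then obtain B where "B \<in> Q" "s \<in> B" by blast
  have "A = orbit f s" "B = orbit f s"
    using A s assms(3,4) \<open>B \<in> Q\<close> \<open>s \<in> B\<close> unfolding cyclic_perms_def cyclic_on_alldef by blast+
  with \<open>B \<in> Q\<close> show "A \<in> Q" by simp
qed

text \<open>Grouping permutations by their orbit partition. The right-hand side is the Leibniz
  expansion of the determinant of the 0-1 matrix of \<open>R\<close> on \<open>S\<close>.\<close>

lemma sum_sign_partitions:
  assumes "finite S"
  shows "(\<Sum>P | partition_on S P. \<Prod>A\<in>P. \<Sum>f\<in>cyclic_perms R {A}. sign f)
    = (\<Sum>f | f permutes S \<and> (\<forall>e\<in>S. R e (f e)). sign f)"
proof -
  have "finite {f. f permutes S}" using assms by (rule finite_permutations)
  then have fin: "finite (cyclic_perms R P)" if "partition_on S P" for P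
    by (rule rev_finite_subset) (use that in \<open>auto simp: cyclic_perms_def partition_on_def\<close>)
  have "(\<Sum>P | partition_on S P. \<Prod>A\<in>P. \<Sum>f\<in>cyclic_perms R {A}. sign f)
      = (\<Sum>P | partition_on S P. \<Sum>f\<in>cyclic_perms R P. sign f)"
  proof (rule sum.cong[OF refl])
    fix P assume "P \<in> {P. partition_on S P}"
    then have P: "partition_on S P" by simp
    show "(\<Prod>A\<in>P. \<Sum>f\<in>cyclic_perms R {A}. sign f) = (\<Sum>f\<in>cyclic_perms R P. sign f)"
      using P assms finite_elements[OF assms P]
      by (intro sum_sign_cyclic_perms[symmetric])
        (auto simp: partition_on_def intro: finite_subset)
  qed
  also have "\<dots> = (\<Sum>f\<in>(\<Union>P\<in>{P. partition_on S P}. cyclic_perms R P). sign f)"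
  proof (rule sum.UNION_disjoint[symmetric])
    show "finite {P. partition_on S P}" using assms by (rule finitely_many_partition_on)
    show "\<forall>P\<in>{P. partition_on S P}. finite (cyclic_perms R P)" using fin by simp
    show "\<forall>P\<in>{P. partition_on S P}. \<forall>Q\<in>{P. partition_on S P}. P \<noteq> Q \<longrightarrow>
        cyclic_perms R P \<inter> cyclic_perms R Q = {}"
      using cyclic_perms_partition_unique[of S _ _ _ R] by blast
  qed
  finally show ?thesis unfolding UN_cyclic_perms[OF assms] .
qed

text \<open>A determinant with two equal rows vanishes:
  \<open>f \<mapsto> f \<circ> transpose a b\<close> is a sign-reversing involution, and it respects
  \<open>R\<close> because rows \<open>a\<close> and \<open>b\<close> agree.\<close>

lemma sum_sign_transpose:
  assumes "finite S" "a \<in> S" "b \<in> S" "a \<noteq> b" "R a = R b"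
  shows "(\<Sum>f | f permutes S \<and> (\<forall>e\<in>S. R e (f e)). sign f) = 0" (is "sum sign ?F = 0")
proof -
  let ?t = "transpose a b"
  have t: "?t permutes S" using assms by (intro permutes_swap_id)
  have closed: "f \<circ> ?t \<in> ?F" if f: "f \<in> ?F" for f
  proof -
    have "R e (f (?t e))" if "e \<in> S" for e
    proof -
      have "R e = R (?t e)" using assms by (auto simp: transpose_def)
      moreover have "?t e \<in> S" using t that by (simp add: permutes_in_image)
      ultimately show ?thesis using f by simp
    qed
    then show ?thesis using f t by (auto intro: permutes_compose)
  qed
  have "sum sign ?F = (\<Sum>f\<in>?F. - sign f)"
  proof (rule sum.reindex_bij_witness[where i = "\<lambda>f. f \<circ> ?t" and j = "\<lambda>f. f \<circ> ?t"])
    fix f assume f: "f \<in> ?F"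
    show "f \<circ> ?t \<circ> ?t = f" "f \<circ> ?t \<circ> ?t = f" by (simp_all add: o_assoc[symmetric])
    show "f \<circ> ?t \<in> ?F" "f \<circ> ?t \<in> ?F" using closed[OF f] by blast+
    have "permutation f" using f assms(1) permutation_permutes by blast
    then show "- sign (f \<circ> ?t) = sign f"
      using assms(4) by (simp add: sign_compose permutation_swap_id sign_swap_id)
  qed
  then show ?thesis by (simp add: sum_negf)
qed


section \<open>Circuits as cyclic permutations\<close>

text \<open>Both lists run through the vertices of the walk, read off once from the tails and once
  from the heads.\<close>

lemma (in pre_digraph) cas_iff_map: "cas u p v \<longleftrightarrow> map (tail G) p @ [v] = u # map (head G) p"
  by (induction p arbitrary: u) auto

lemma arc_subgraph_simps [simp]:
  "verts (arc_subgraph G A) = tail G ` A \<union> head G ` A" "arcs (arc_subgraph G A) = A"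
  "tail (arc_subgraph G A) = tail G" "head (arc_subgraph G A) = head G"
  by (simp_all add: arc_subgraph_def)

lemma closed_trails_arc_subgraph:
  assumes "set p = A"
  shows "p \<in> closed_trails (arc_subgraph G A) \<longleftrightarrow>
    p \<noteq> [] \<and> distinct p \<and> (\<forall>e\<in>A. tail G (cycle_of_list p e) = head G e)"
proof (cases "p \<noteq> [] \<and> distinct p")
  case True
  then obtain e es where p: "p = e # es" by (cases p) auto
  interpret pre_digraph "arc_subgraph G A" .
  have "p \<in> closed_trails (arc_subgraph G A) \<longleftrightarrow> (\<exists>u\<in>tail G ` A \<union> head G ` A. cas u p u)"
    using True assms unfolding closed_trails_def trail_def awalk_def by auto
  \<comment> \<open>The first entries force \<open>u = tail G e\<close>; moving this entry to the
    end on the tail side gives the tails of \<open>rotate1 p\<close>.\<close>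
  also have "\<dots> \<longleftrightarrow> map (tail G) (rotate1 p) = map (head G) p"
    using assms by (auto simp: cas_iff_map p)
  also have "\<dots> \<longleftrightarrow> (\<forall>e\<in>A. tail G (cycle_of_list p e) = head G e)"
    using assms True by (simp add: map_cycle_of_list[symmetric])
  finally show ?thesis using True by blast
qed (auto simp: closed_trails_def pre_digraph.trail_def)

lemma card_euler_circuits:
  "card (euler_circuits (arc_subgraph G A)) = card (cyclic_perms (\<lambda>e e'. tail G e' = head G e) {A})"
proof -
  let ?F = "cyclic_perms (\<lambda>e e'. tail G e' = head G e) {A}"
  \<comment> \<open>A permutation is sent to the set of all lists that represent it. This set is a
    full rotation class, so no representative has to be chosen.\<close>
  let ?lists = "\<lambda>f. {p. p \<noteq> [] \<and> distinct p \<and> set p = A \<and> cycle_of_list p = f}"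
  have "bij_betw ?lists ?F (euler_circuits (arc_subgraph G A))"
    unfolding bij_betw_def
  proof (intro conjI set_eqI iffI)
    have nonempty: "\<exists>p. p \<in> ?lists f" if "f \<in> ?F" for f
      using that ex_cycle_of_list[of f A] by (auto simp: cyclic_perms_def)
    have rot: "?lists (cycle_of_list p) = cyclic_rotation `` {p}"
      if "p \<noteq> []" "distinct p" "set p = A" for p
    proof (intro set_eqI iffI)
      fix q
      show "q \<in> cyclic_rotation `` {p}" if "q \<in> ?lists (cycle_of_list p)"
        using that \<open>distinct p\<close> \<open>set p = A\<close> cycle_of_list_eqD[of p q]
        by (auto simp: cyclic_rotation_def)
      assume "q \<in> cyclic_rotation `` {p}"
      then obtain n where "q = rotate n p" by (auto simp: cyclic_rotation_def)
      then show "q \<in> ?lists (cycle_of_list p)"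
        using that cycle_of_list_rotate_independent[OF \<open>distinct p\<close>, of n] by simp
    qed
    show "inj_on ?lists ?F"
    proof (rule inj_onI)
      fix f g assume "f \<in> ?F" "?lists f = ?lists g"
      with nonempty[of f] show "f = g" by blast
    qed
    fix C
    show "C \<in> euler_circuits (arc_subgraph G A)" if "C \<in> ?lists ` ?F"
    proof -
      from that obtain f where f: "f \<in> ?F" "C = ?lists f" by blast
      then obtain p where p: "p \<in> ?lists f" using nonempty by blast
      then have "p \<in> closed_trails (arc_subgraph G A)"
        using f by (auto simp: closed_trails_arc_subgraph cyclic_perms_def)
      moreover have "C = cyclic_rotation `` {p}" using f p rot[of p] by auto
      ultimately have "C \<in> circuits (arc_subgraph G A)"
        by (auto simp: circuits_def quotient_def)
      then show ?thesis using f by (auto simp: euler_circuits_def)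
    qed
    show "C \<in> ?lists ` ?F" if C: "C \<in> euler_circuits (arc_subgraph G A)"
    proof -
      from C obtain p where p: "p \<in> closed_trails (arc_subgraph G A)"
        and Cp: "C = cyclic_rotation `` {p}"
        by (auto simp: euler_circuits_def circuits_def quotient_def)
      have "p \<in> C" using equiv_class_self[OF equiv_cyclic_rotation] Cp by blast
      then have set_p: "set p = A"
        using C by (auto simp: euler_circuits_def)
      with p have *: "p \<noteq> []" "distinct p" "\<forall>e\<in>A. tail G (cycle_of_list p e) = head G e"
        by (auto simp: closed_trails_arc_subgraph)
      then have "cycle_of_list p \<in> ?F"
        using cyclic_on_cycle_of_list[of p] cycle_permutes[of p] set_p
        by (auto simp: cyclic_perms_def)
      moreover have "C = ?lists (cycle_of_list p)" using rot[of p] * set_p Cp by simp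
      ultimately show ?thesis by blast
    qed
  qed
  then show ?thesis by (rule bij_betw_same_card[symmetric])
qed

section \<open>Partition weights as signed sums, and their cancellation\<close>

lemma partition_weight_eq:
  assumes "finite (arcs G)" "partition_on (arcs G) P"
  shows "partition_weight G P
    = (-1) ^ card (arcs G) * (\<Prod>A\<in>P. \<Sum>f\<in>cyclic_perms (\<lambda>e e'. tail G e' = head G e) {A}. sign f)"
proof -
  let ?F = "\<lambda>A. cyclic_perms (\<lambda>e e'. tail G e' = head G e) {A}"
  have "- int (card (euler_circuits (arc_subgraph G A))) = (-1) ^ card A * (\<Sum>f\<in>?F A. sign f)" for A
  proof -
    \<comment> \<open>Each summand is -1, as the two equal powers multiply to 1; the sum is
      therefore minus the number of circuits.\<close>
    have "(-1) ^ card A * (\<Sum>f\<in>?F A. sign f) = (\<Sum>f\<in>?F A. (-1) ^ card A * (- ((-1) ^ card A)))"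
      unfolding sum_distrib_left
      by (intro sum.cong) (auto simp: cyclic_perms_def sign_cyclic_on)
    then show ?thesis by (simp add: card_euler_circuits flip: power_add mult_2)
  qed
  then have "partition_weight G P = (\<Prod>A\<in>P. (-1) ^ card A) * (\<Prod>A\<in>P. \<Sum>f\<in>?F A. sign f)"
    by (simp add: partition_weight_def prod.distrib)
  \<comment> \<open>The block sizes add up to the number of arcs, so this factor is the same for all
    partitions.\<close>
  also have "(\<Prod>A\<in>P. (-1) ^ card A) = (-1 :: int) ^ card (arcs G)"
  proof -
    have "card (arcs G) = (\<Sum>A\<in>P. card A)"
      using assms by (intro product_partition) (auto intro: finite_subset dest: partition_onD1)
    then show ?thesis by (simp add: power_sum)
  qed
  finally show ?thesis .
qed

text \<open>After its start, an Eulerian closed trail visits the heads of its arcs in turn. The arcs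
  are distinct, so injectivity of \<open>head G\<close> rules out a repeated vertex.\<close>

lemma (in wf_digraph) is_cycle_if_inj_head:
  assumes "connected G" "eulerian G" "inj_on (head G) (arcs G)"
  shows "is_cycle G"
proof -
  obtain C where C: "C \<in> euler_circuits G" using assms by (auto simp: eulerian_def)
  then obtain p where "C = cyclic_rotation `` {p}"
    by (auto simp: euler_circuits_def circuits_def quotient_def)
  then have "p \<in> C" using equiv_class_self[OF equiv_cyclic_rotation] by blast
  with C have "p \<in> closed_trails G" and set_p: "set p = arcs G"
    using circuit_subset_closed_trails[of C] by (auto simp: euler_circuits_def)
  then obtain u where p: "p \<noteq> []" "trail u p u" by (auto simp: closed_trails_def)
  then have walk: "awalk u p u" and "cas u p u" "distinct p"
    by (auto simp: trail_def awalk_def)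
  then have map: "map (tail G) p @ [u] = u # map (head G) p" by (simp add: cas_iff_map)
  \<comment> \<open>The last arc ends in \<open>u\<close>, so \<open>u\<close> can stand for the
    final vertex in \<open>awalk_verts\<close>.\<close>
  then have "last (u # map (head G) p) = u" by (metis last_snoc)
  then have "awalk_verts u p = map (tail G) p @ [u]"
    using p by (simp add: awalk_verts_conv last_map)
  then have "tl (awalk_verts u p) = map (head G) p" by (simp add: map)
  then have "pre_digraph.cycle G p"
    using walk p \<open>distinct p\<close> assms(3) set_p by (auto simp: cycle_def distinct_map)
  moreover have "euler_trail u p u"
    using p set_p assms(1) by (simp add: euler_trail_conv_connected)
  ultimately show ?thesis by (auto simp: is_cycle_def)
qed

theorem theorem3p11:
  fixes D :: "('a, 'b) pre_digraph"
  assumes "fin_digraph D" and "loopfree_digraph D"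
    and "connected D" and "eulerian D" and "\<not> is_cycle D"
  shows "(\<Sum>P | partition_on (arcs D) P. partition_weight D P) = 0"
proof -
  interpret fin_digraph D by fact
  let ?R = "\<lambda>e e'. tail D e' = head D e"
  \<comment> \<open>Two arcs with a common head have the same admissible successors: these are the
    equal rows of \<open>?R\<close>.\<close>
  have "\<not> inj_on (head D) (arcs D)"
    using is_cycle_if_inj_head assms by blast
  then obtain a b where "a \<in> arcs D" "b \<in> arcs D" "a \<noteq> b" "head D a = head D b"
    by (auto simp: inj_on_def)
  then have "(\<Sum>f | f permutes arcs D \<and> (\<forall>e\<in>arcs D. ?R e (f e)). sign f) = 0"
    by (intro sum_sign_transpose[of _ a b]) auto
  then have "(\<Sum>P | partition_on (arcs D) P. \<Prod>A\<in>P. \<Sum>f\<in>cyclic_perms ?R {A}. sign f) = 0"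
    by (simp add: sum_sign_partitions)
  then show ?thesis
    by (simp add: partition_weight_eq flip: sum_distrib_left)
qed

end
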